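(* Let $\sigma=\sigma_1\sigma_2\cdots\sigma_k$ be a permutation of length $k\ge 3$, and let $\hat\sigma=\sigma_2\sigma_1\sigma_3\cdots\sigma_k$. Then the set $\mathrm{Sort}(\sigma)$ of $\sigma$-sortable permutations is a permutation class if and only if $\hat\sigma$ contains the pattern $231$.
   Context: Permutations are written in one-line notation. A permutation $\pi$ contains a pattern $\tau$ if some (not necessarily consecutive) subsequence of $\pi$ is order isomorphic to $\tau$; otherwise $\pi$ avoids $\tau$. A permutation class is a set of permutations closed downwards under pattern containment. For a permutation $\sigma$ of length at least $2$, the $\sigma$-stack acts on an input permutation $\pi=\pi_1\cdots\pi_n$ as follows (starting with empty stack and output). For $i=1,\dots,n$: as long as pushing $\pi_i$ on top of the stack would make the content of the stack, read from top to bottom, contain an occurrence of $\sigma$, pop the top element and append it to the output; then push $\pi_i$. After all letters have been pushed, pop all remaining elements, from top to bottom, appending them to the output. The resulting output is denoted $\mathcal{S}^{\sigma}(\pi)$. The permutation $\pi$ of length $n$ is $\sigma$-sortable if $\mathcal{S}^{21}(\mathcal{S}^{\sigma}(\pi))=12\cdots n$. $\mathrm{Sort}(\sigma)$ is the set of $\sigma$-sortable permutations. *)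

theory Defs
  imports Main "HOL-Library.Sublist" "HOL-Combinatorics.Multiset_Permutations"
begin

(* A permutation in one-line notation is the list of its values 1, ..., n.
   The empty list is the permutation of length 0. *)
definition is_perm :: "nat list \<Rightarrow> bool" where
  "is_perm \<pi> \<longleftrightarrow> \<pi> \<in> permutations_of_set {1..length \<pi>}"

definition order_isomorphic :: "nat list \<Rightarrow> nat list \<Rightarrow> bool" where
  "order_isomorphic u v \<longleftrightarrow>
     length u = length v \<and>
     (\<forall>i<length u. \<forall>j<length u. u ! i < u ! j \<longleftrightarrow> v ! i < v ! j)"

(* Also applied to the content of a stack, which is a sequence of distinct
   values but not necessarily a permutation of an initial segment. *)
definition contains :: "nat list \<Rightarrow> nat list \<Rightarrow> bool" where
  "contains w \<tau> \<longleftrightarrow> (\<exists>u. subseq u w \<and> order_isomorphic u \<tau>)"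

definition perm_class :: "nat list set \<Rightarrow> bool" where
  "perm_class C \<longleftrightarrow>
     (\<forall>\<pi>\<in>C. is_perm \<pi>) \<and>
     (\<forall>\<pi>\<in>C. \<forall>\<tau>. is_perm \<tau> \<and> contains \<pi> \<tau> \<longrightarrow> \<tau> \<in> C)"

(* stack_run \<sigma> xs s is what is output from now on when xs is the remaining input
   and s is the stack, whose head is its top.  Pushing on the empty stack is always
   allowed: since \<sigma> has length at least 2, a single letter does not contain it. *)
fun stack_run :: "nat list \<Rightarrow> nat list \<Rightarrow> nat list \<Rightarrow> nat list" where
  "stack_run \<sigma> [] s = s"
| "stack_run \<sigma> (x # xs) [] = stack_run \<sigma> xs [x]"
| "stack_run \<sigma> (x # xs) (y # s) =
     (if contains (x # y # s) \<sigma> then y # stack_run \<sigma> (x # xs) s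
      else stack_run \<sigma> xs (x # y # s))"

definition stack_map :: "nat list \<Rightarrow> nat list \<Rightarrow> nat list" where
  "stack_map \<sigma> \<pi> = stack_run \<sigma> \<pi> []"

definition Sort :: "nat list \<Rightarrow> nat list set" where
  "Sort \<sigma> = {\<pi>. is_perm \<pi> \<and> stack_map [2, 1] (stack_map \<sigma> \<pi>) = [1..<Suc (length \<pi>)]}"

fun swap_first_two :: "nat list \<Rightarrow> nat list" where
  "swap_first_two (a # b # r) = b # a # r"
| "swap_first_two w = w"

end

theory Submission
  imports Defs
begin

text \<open>
  Passing through the 21-stack is ordinary stack sorting, so a permutation is \<open>\<sigma>\<close>-sortable iff the
  output of the \<open>\<sigma>\<close>-stack avoids 231 (\<open>mem_Sort_iff\<close>). Write \<open>\<sigma>hat\<close> for \<open>swap_first_two \<sigma>\<close>.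

  If the restriction never forces a pop, the \<open>\<sigma>\<close>-stack just reverses its input. If it does force
  one, consider the last letter \<open>y\<close> popped before \<open>x\<close> can be pushed. Just before that pop \<open>x\<close> and \<open>y\<close>
  played the first two letters of an occurrence of \<open>\<sigma>\<close>; now \<open>y\<close> leaves first, then \<open>x\<close>, then the
  rest of the occurrence, and the output contains \<open>\<sigma>hat\<close> (\<open>stack_run_contains_swap\<close>). Hence if
  \<open>\<sigma>hat\<close> contains 231, a forced pop is fatal, and the sortable permutations are exactly those whose
  reversal avoids \<open>\<sigma>\<close> and 231 (\<open>mem_Sort_iff_avoids\<close>). This is a class.

  Suppose now that \<open>\<sigma>hat\<close> avoids 231. Unless \<open>\<sigma> = 231\<close>, the permutation 132 is reversed to 231
  and so is not sortable. It remains to exhibit a sortable permutation containing 132. The common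
  device is to feed the stack a copy of \<open>rev \<sigma>\<close> with additional letters; one letter near its end
  forces all pops, and the letters popped include the 3 of an occurrence of 132, so that this occurrence does
  not come out as 231. With \<open>k\<close> the length of \<open>\<sigma> = s # t # r\<close>, three shapes suffice:

  \<^item> if \<open>1 < s < k\<close>, insert a new maximum just before the last letter \<open>s\<close> of \<open>rev \<sigma>\<close>; then
    \<open>\<sigma>hat\<close> comes out behind this maximum;
  \<^item> if \<open>s = 1\<close>, insert in addition a new minimum between \<open>r\<close> and \<open>t\<close>, to play the 1 of 132;
  \<^item> if \<open>s = k\<close>, then \<open>t = 1\<close> because \<open>\<sigma>hat\<close> avoids 231; the input is \<open>rev r\<close>, \<open>1\<close>, \<open>3\<close>, \<open>k + 2\<close>, \<open>2\<close>
    with \<open>r\<close> shifted up by two, where \<open>k + 2\<close> pops both 3 and 1.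

  For \<open>\<sigma> = 231\<close> the permutation 132 is sortable, but the sortable permutation 361425 contains the unsortable 1324.
\<close>

text \<open>The patterns are literal lists of numerals, which rewriting \<open>1\<close> to \<open>Suc 0\<close> would hide from the
  lemmas about them.\<close>

declare One_nat_def [simp del]

section \<open>Pattern containment\<close>

lemma is_perm_iff: "is_perm \<pi> \<longleftrightarrow> distinct \<pi> \<and> set \<pi> = {1..length \<pi>}"
  unfolding is_perm_def permutations_of_set_def by auto

lemma order_isomorphic_map:
  "order_isomorphic (map f ps) (map g ps) \<longleftrightarrow>
     (\<forall>p\<in>set ps. \<forall>q\<in>set ps. f p < f q \<longleftrightarrow> g p < g q)"
  unfolding order_isomorphic_def by (auto simp: all_set_conv_all_nth)

lemma order_isomorphic_map_strict_mono:
  assumes "strict_mono_on (set v) f"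
  shows "order_isomorphic (map f v) v"
  using order_isomorphic_map[of f v id] assms by (simp add: strict_mono_on_less)

lemma order_isomorphic_refl [simp]: "order_isomorphic u u"
  unfolding order_isomorphic_def by simp

lemma order_isomorphic_trans:
  "order_isomorphic u v \<Longrightarrow> order_isomorphic v w \<Longrightarrow> order_isomorphic u w"
  unfolding order_isomorphic_def by simp

lemma order_isomorphic_length: "order_isomorphic u v \<Longrightarrow> length u = length v"
  unfolding order_isomorphic_def by simp

text \<open>An order isomorphism is a list of pairs whose two projections induce the same order. In this form
  reversing, swapping letters and passing to a subsequence act on both sides at once.\<close>

lemma order_isomorphic_zipE:
  assumes "order_isomorphic u v"
  obtains ps where "u = map fst ps" "v = map snd ps"
    "\<And>p q. p \<in> set ps \<Longrightarrow> q \<in> set ps \<Longrightarrow> fst p < fst q \<longleftrightarrow> snd p < snd q"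
proof
  have len: "length u = length v" using assms by (rule order_isomorphic_length)
  show u: "u = map fst (zip u v)" and v: "v = map snd (zip u v)" using len by simp_all
  show "fst p < fst q \<longleftrightarrow> snd p < snd q" if "p \<in> set (zip u v)" "q \<in> set (zip u v)" for p q
    using assms that unfolding order_isomorphic_def set_zip by auto
qed

lemma order_isomorphic_rev: "order_isomorphic u v \<Longrightarrow> order_isomorphic (rev u) (rev v)"
  by (erule order_isomorphic_zipE) (simp add: rev_map order_isomorphic_map)

lemma order_isomorphic_swap:
  "order_isomorphic (a # b # u) (c # d # v) \<Longrightarrow> order_isomorphic (b # a # u) (d # c # v)"
proof (erule order_isomorphic_zipE)
  fix ps :: "(nat \<times> nat) list"
  assume u: "a # b # u = map fst ps" and v: "c # d # v = map snd ps"
    and iso: "\<And>p q. p \<in> set ps \<Longrightarrow> q \<in> set ps \<Longrightarrow> fst p < fst q \<longleftrightarrow> snd p < snd q"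
  from u v obtain p q qs where "ps = p # q # qs" "a = fst p" "c = snd p" "b = fst q" "d = snd q"
    "u = map fst qs" "v = map snd qs" by (auto simp: map_eq_Cons_conv Cons_eq_map_conv)
  then show ?thesis
    using order_isomorphic_map[of fst "q # p # qs" snd] iso by auto
qed

text \<open>This and the next lemma refute order isomorphisms in the constructions below: whether the first
  letter is the largest, or the smallest, is invariant.\<close>

lemma order_isomorphic_head_max:
  assumes "order_isomorphic (x # u) (y # v)"
  shows "(\<forall>z\<in>set u. z < x) \<longleftrightarrow> (\<forall>z\<in>set v. z < y)"
  using assms
proof (rule order_isomorphic_zipE)
  fix ps :: "(nat \<times> nat) list"
  assume u: "x # u = map fst ps" and v: "y # v = map snd ps"
    and iso: "\<And>p q. p \<in> set ps \<Longrightarrow> q \<in> set ps \<Longrightarrow> fst p < fst q \<longleftrightarrow> snd p < snd q"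
  from u v obtain p qs where "ps = p # qs" "x = fst p" "y = snd p" "u = map fst qs" "v = map snd qs"
    by (auto simp: map_eq_Cons_conv Cons_eq_map_conv)
  then show ?thesis using iso by auto
qed

lemma order_isomorphic_head_min:
  assumes "order_isomorphic (x # u) (y # v)"
  shows "(\<forall>z\<in>set u. x < z) \<longleftrightarrow> (\<forall>z\<in>set v. y < z)"
  using assms
proof (rule order_isomorphic_zipE)
  fix ps :: "(nat \<times> nat) list"
  assume u: "x # u = map fst ps" and v: "y # v = map snd ps"
    and iso: "\<And>p q. p \<in> set ps \<Longrightarrow> q \<in> set ps \<Longrightarrow> fst p < fst q \<longleftrightarrow> snd p < snd q"
  from u v obtain p qs where "ps = p # qs" "x = fst p" "y = snd p" "u = map fst qs" "v = map snd qs"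
    by (auto simp: map_eq_Cons_conv Cons_eq_map_conv)
  then show ?thesis using iso by auto
qed

lemma subseq_rev: "subseq u w \<Longrightarrow> subseq (rev u) (rev w)"
  by (induction rule: list_emb.induct) (auto intro: list_emb_append_mono)

lemma contains_if_order_isomorphic: "order_isomorphic w \<tau> \<Longrightarrow> contains w \<tau>"
  unfolding contains_def by blast

lemma contains_subseq: "subseq v w \<Longrightarrow> contains v \<tau> \<Longrightarrow> contains w \<tau>"
  unfolding contains_def by (meson subseq_order.trans)

lemma contains_length: "contains w \<tau> \<Longrightarrow> length \<tau> \<le> length w"
  unfolding contains_def using list_emb_length order_isomorphic_length by metis

lemma contains_same_length:
  "length w = length \<tau> \<Longrightarrow> contains w \<tau> \<longleftrightarrow> order_isomorphic w \<tau>"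
  unfolding contains_def by (metis order_isomorphic_length subseq_order.refl subseq_same_length)

lemma contains_rev: "contains w \<tau> \<Longrightarrow> contains (rev w) (rev \<tau>)"
  unfolding contains_def using order_isomorphic_rev subseq_rev by blast

text \<open>The positions \<open>N\<close> of \<open>\<rho>\<close> inside \<open>\<tau>\<close> select an occurrence of \<open>\<rho>\<close> inside the occurrence of \<open>\<tau>\<close>.\<close>

lemma contains_trans:
  assumes "contains w \<tau>" "contains \<tau> \<rho>"
  shows "contains w \<rho>"
proof -
  obtain u v where u: "subseq u w" "order_isomorphic u \<tau>" and v: "subseq v \<tau>" "order_isomorphic v \<rho>"
    using assms unfolding contains_def by blast
  from u(2) obtain ps where ps: "u = map fst ps" "\<tau> = map snd ps"
    "\<And>p q. p \<in> set ps \<Longrightarrow> q \<in> set ps \<Longrightarrow> fst p < fst q \<longleftrightarrow> snd p < snd q"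
    by (rule order_isomorphic_zipE) blast
  from v(1) obtain N where N: "v = nths \<tau> N" unfolding subseq_conv_nths by blast
  define qs where "qs = nths ps N"
  have "v = map snd qs" by (simp add: N ps qs_def nths_map)
  moreover have "set qs \<subseteq> set ps" by (simp add: qs_def set_nths_subset)
  ultimately have "order_isomorphic (map fst qs) v"
    using ps(3) by (fastforce simp: order_isomorphic_map)
  moreover have "subseq (map fst qs) u"
    unfolding ps subseq_conv_nths qs_def by (auto simp: nths_map)
  ultimately show ?thesis
    using u(1) v(2) order_isomorphic_trans subseq_order.trans unfolding contains_def by blast
qed

lemma order_isomorphic_sym: "order_isomorphic u v \<Longrightarrow> order_isomorphic v u"
  unfolding order_isomorphic_def by simp

lemma contains_order_isomorphic_cong:
  assumes "order_isomorphic v w"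
  shows "contains v \<tau> \<longleftrightarrow> contains w \<tau>"
  using contains_trans[OF contains_if_order_isomorphic[OF assms], of \<tau>]
    contains_trans[OF contains_if_order_isomorphic[OF order_isomorphic_sym[OF assms]], of \<tau>] by (rule iffI[rotated])

text \<open>A letter above everything else could only play the first letter of the pattern, which is
  impossible when that letter is not the maximum of the pattern. So the stack for such a pattern always accepts a maximum.\<close>

lemma contains_Cons_max:
  assumes "\<forall>z\<in>set w. z < c" and "\<exists>z\<in>set \<tau>. t < z" and "contains (c # w) (t # \<tau>)"
  shows "contains w (t # \<tau>)"
proof -
  obtain u where u: "subseq u (c # w)" "order_isomorphic u (t # \<tau>)"
    using assms(3) unfolding contains_def by blast
  then obtain a v where a: "u = a # v" by (cases u) (auto simp: order_isomorphic_def)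
  have "a \<noteq> c"
  proof
    assume "a = c"
    then have "subseq v w" using u(1) a by simp
    then have "\<forall>z\<in>set v. z < a" using assms(1) \<open>a = c\<close> by (fastforce elim: list_emb_set)
    then show False
      using order_isomorphic_head_max[of a v t \<tau>] u(2) a assms(2) by auto
  qed
  then have "subseq u w" using u(1) a by simp
  then show ?thesis using u(2) unfolding contains_def by blast
qed

section \<open>The pattern 231\<close>

lemma ex_subseq_pair_Cons:
  "(\<exists>a b. subseq [a, b] (x # w) \<and> P a b) \<longleftrightarrow>
     (\<exists>a b. subseq [a, b] w \<and> P a b) \<or> (\<exists>b\<in>set w. P x b)" (is "?l \<longleftrightarrow> ?r")
proof
  assume ?l
  then obtain a b where "subseq [a, b] (x # w)" "P a b" by blast
  then show ?r by (cases "a = x") (auto simp: subseq_singleton_left)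
next
  assume ?r
  then show ?l by (metis list_emb_Cons subseq_Cons2 subseq_singleton_left)
qed

text \<open>Says that putting \<open>x\<close> in front of \<open>w\<close> creates an occurrence of 231 in which \<open>x\<close> is the 2.\<close>

definition straddled :: "nat \<Rightarrow> nat list \<Rightarrow> bool" where
  "straddled x w \<longleftrightarrow> (\<exists>b c. subseq [b, c] w \<and> c < x \<and> x < b)"

lemma straddled_Nil [simp]: "\<not> straddled x []"
  unfolding straddled_def by simp

lemma straddled_Cons [simp]:
  "straddled x (y # w) \<longleftrightarrow> straddled x w \<or> x < y \<and> (\<exists>c\<in>set w. c < x)"
  unfolding straddled_def ex_subseq_pair_Cons by auto

lemma straddled_append:
  "straddled x (u @ v) \<longleftrightarrow>
     straddled x u \<or> straddled x v \<or> (\<exists>b\<in>set u. x < b) \<and> (\<exists>c\<in>set v. c < x)"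
  by (induction u) auto

lemma contains_231_iff:
  "contains w [2, 3, 1] \<longleftrightarrow> (\<exists>a b c. subseq [a, b, c] w \<and> c < a \<and> a < b)"
proof -
  have iso: "order_isomorphic [a, b, c] [2, 3, 1] \<longleftrightarrow> c < a \<and> a < b" for a b c
    using order_isomorphic_map[of fst "[(a, 2), (b, 3), (c, 1)]" snd] by auto
  have "\<exists>a b c. u = [a, b, c]" if "order_isomorphic u [2, 3, 1]" for u
    using order_isomorphic_length[OF that] by (auto simp: length_Suc_conv)
  then show ?thesis unfolding contains_def using iso by metis
qed

lemma contains_231_Nil [simp]: "\<not> contains [] [2, 3, 1]"
  by (simp add: contains_231_iff)

lemma contains_231_Cons [simp]:
  "contains (x # w) [2, 3, 1] \<longleftrightarrow> contains w [2, 3, 1] \<or> straddled x w"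
proof
  assume "contains (x # w) [2, 3, 1]"
  then obtain a b c where "subseq [a, b, c] (x # w)" "c < a" "a < b"
    unfolding contains_231_iff by blast
  then show "contains w [2, 3, 1] \<or> straddled x w"
    unfolding contains_231_iff straddled_def by (cases "a = x") auto
next
  assume "contains w [2, 3, 1] \<or> straddled x w"
  then show "contains (x # w) [2, 3, 1]"
    unfolding contains_231_iff straddled_def by (metis list_emb_Cons subseq_Cons2)
qed

text \<open>The three new disjuncts are the occurrences in which \<open>y\<close> is the 2, the 3 and the 1.\<close>

lemma contains_231_insert:
  "contains (u @ y # v) [2, 3, 1] \<longleftrightarrow>
     contains (u @ v) [2, 3, 1] \<or> straddled y v \<or>
     (\<exists>a\<in>set u. a < y \<and> (\<exists>c\<in>set v. c < a)) \<or> (\<exists>a b. subseq [a, b] u \<and> y < a \<and> a < b)"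
proof (induction u)
  case (Cons x u)
  have 1: "straddled x (u @ y # v) \<longleftrightarrow> straddled x (u @ v) \<or>
      x < y \<and> (\<exists>c\<in>set v. c < x) \<or> (\<exists>b\<in>set u. x < b) \<and> y < x"
    by (auto simp: straddled_append)
  have 2: "(\<exists>a b. subseq [a, b] (x # u) \<and> y < a \<and> a < b) \<longleftrightarrow>
      (\<exists>a b. subseq [a, b] u \<and> y < a \<and> a < b) \<or> (\<exists>b\<in>set u. y < x \<and> x < b)"
    by (rule ex_subseq_pair_Cons)
  show ?case
    unfolding append_Cons contains_231_Cons Cons.IH 1 2 list.set by blast
qed simp

lemma not_straddled_max: "\<forall>z\<in>set w. z \<le> x \<Longrightarrow> \<not> straddled x w"
  by (induction w) auto

lemma not_straddled_min: "\<forall>z\<in>set w. x \<le> z \<Longrightarrow> \<not> straddled x w"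
  by (induction w) auto

section \<open>Forced pops in the stack\<close>

lemma mset_stack_run: "mset (stack_run \<sigma> xs s) = mset xs + mset s"
  by (induction \<sigma> xs s rule: stack_run.induct) auto

lemma set_stack_run: "set (stack_run \<sigma> xs s) = set xs \<union> set s"
  using mset_stack_run[of \<sigma> xs s] by (metis set_mset_mset set_mset_union)

text \<open>Letters already on the stack leave it from top to bottom.\<close>

lemma subseq_stack_run: "subseq s (stack_run \<sigma> xs s)"
proof (induction \<sigma> xs s rule: stack_run.induct)
  case (3 \<sigma> x xs y s)
  then show ?case by (auto dest: subseq_Cons')
qed auto

lemma stack_run_push:
  "\<not> contains (x # s) \<sigma> \<Longrightarrow> stack_run \<sigma> (x # xs) s = stack_run \<sigma> xs (x # s)"
  by (cases s) auto

text \<open>The stack content at any time during \<open>xs\<close> is a suffix of \<open>rev xs @ s\<close>, so nothing is popped.\<close>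

lemma stack_run_append_avoiding:
  "\<not> contains (rev xs @ s) \<sigma> \<Longrightarrow> stack_run \<sigma> (xs @ ys) s = stack_run \<sigma> ys (rev xs @ s)"
proof (induction xs arbitrary: s)
  case (Cons x xs)
  have "\<not> contains (x # s) \<sigma>" using Cons.prems contains_subseq[of "x # s" "rev xs @ x # s"] by auto
  then show ?case using Cons stack_run_push[of x s \<sigma> "xs @ ys"] by simp
qed simp

text \<open>As long as \<open>y\<close> is on the stack, so is the rest of an occurrence begun by \<open>x\<close>: all of \<open>p\<close> and \<open>y\<close>
  have to go, and nothing more.\<close>

lemma stack_run_pop:
  assumes "contains (x # y # q) \<sigma>" "\<not> contains (x # q) \<sigma>"
  shows "stack_run \<sigma> (x # xs) (p @ y # q) = p @ y # stack_run \<sigma> xs (x # q)"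
proof (induction p)
  case Nil
  then show ?case using assms by (simp add: stack_run_push)
next
  case (Cons z p)
  have "contains (x # z # p @ y # q) \<sigma>"
  proof (rule contains_subseq[OF _ assms(1)])
    have "subseq (y # q) ((z # p) @ y # q)" by (rule list_emb_append2) simp
    then show "subseq (x # y # q) (x # z # p @ y # q)" by (simp only: subseq_Cons2 append_Cons)
  qed
  then show ?case using Cons by simp
qed

lemma stack_map_one_trigger:
  assumes "\<not> contains (p @ y # q) \<sigma>" "contains (x # y # q) \<sigma>" "\<not> contains (x # q) \<sigma>"
  shows "stack_map \<sigma> (rev (p @ y # q) @ x # xs) = p @ y # stack_run \<sigma> xs (x # q)"
  using stack_run_append_avoiding[of "rev (p @ y # q)" "[]" \<sigma> "x # xs"] assms
    stack_run_pop[OF assms(2,3)] by (simp add: stack_map_def)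

lemma stack_map_avoiding: "\<not> contains (rev \<pi>) \<sigma> \<Longrightarrow> stack_map \<sigma> \<pi> = rev \<pi>"
  using stack_run_append_avoiding[of \<pi> "[]" \<sigma> "[]"] by (simp add: stack_map_def)

text \<open>The pop that matters is the one after which \<open>x\<close> can be pushed: the occurrence of \<open>\<sigma>\<close> that
  forced it must start with \<open>x\<close> and the popped letter, and these two leave in the opposite order.\<close>

lemma stack_run_contains_swap:
  assumes "length \<sigma> \<ge> 2" "\<not> contains s \<sigma>" "contains (rev xs @ s) \<sigma>"
  shows "contains (stack_run \<sigma> xs s) (swap_first_two \<sigma>)"
  using assms
proof (induction \<sigma> xs s rule: stack_run.induct)
  case (1 \<sigma> s)
  then show ?case by simp
next
  case (2 \<sigma> x xs)
  have "\<not> contains [x] \<sigma>" using contains_length[of "[x]" \<sigma>] 2(2) by auto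
  then show ?case using 2 by simp
next
  case (3 \<sigma> x xs y s)
  show ?case
  proof (cases "contains (x # y # s) \<sigma>")
    case False
    then show ?thesis using 3 by simp
  next
    case True
    have s: "\<not> contains s \<sigma>" using "3.prems"(2) contains_subseq[of s "y # s"] by auto
    let ?out = "stack_run \<sigma> (x # xs) s"
    have "contains (y # ?out) (swap_first_two \<sigma>)"
    proof (cases "contains (x # s) \<sigma>")
      case xs: True
      then have "contains (rev (x # xs) @ s) \<sigma>" using contains_subseq[of "x # s" "rev (x # xs) @ s"] by auto
      then have "contains ?out (swap_first_two \<sigma>)" using "3.IH"(1)[OF True] "3.prems"(1) s by simp
      then show ?thesis using contains_subseq[of ?out "y # ?out"] by auto
    next
      case False
      obtain a b \<sigma>' where \<sigma>: "\<sigma> = a # b # \<sigma>'"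
        using "3.prems"(1) by (cases \<sigma> rule: swap_first_two.cases) auto
      obtain u where u: "subseq u (x # y # s)" "order_isomorphic u \<sigma>"
        using True unfolding contains_def by blast
      then obtain a' b' u' where u': "u = a' # b' # u'"
        using order_isomorphic_length[OF u(2)] \<sigma> by (auto simp: length_Suc_conv)
      (* Both letters are needed: neither y # s nor x # s contains the pattern. *)
      have "a' = x"
        using u u' "3.prems"(2) unfolding contains_def by (metis subseq_Cons2_neq)
      moreover have "b' = y"
        using u u' False \<open>a' = x\<close> unfolding contains_def by (metis subseq_Cons2_neq subseq_Cons2_iff)
      ultimately have "subseq u' s" using u(1) u' by simp
      then have "subseq (x # u') ?out"
        using subseq_stack_run[of "x # s" \<sigma> xs] False stack_run_push[of x s \<sigma> xs]
        by (metis subseq_Cons2 subseq_order.trans)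
      then have "subseq (y # x # u') (y # ?out)" by simp
      moreover have "order_isomorphic (y # x # u') (swap_first_two \<sigma>)"
        using u(2) u' \<open>a' = x\<close> \<open>b' = y\<close> order_isomorphic_swap \<sigma> by simp
      ultimately show ?thesis unfolding contains_def by blast
    qed
    then show ?thesis using True by simp
  qed
qed

section \<open>Sorting with the 21-stack\<close>

lemma sorted_subseq_pair:
  fixes s :: "nat list"
  assumes "sorted s" "subseq [a, b] s"
  shows "a \<le> b"
proof -
  have "sorted [a, b]" using assms sorted_nths unfolding subseq_conv_nths by metis
  then show ?thesis by simp
qed

lemma sorted_subseq_pair_rev:
  fixes s :: "nat list"
  assumes "sorted s" "subseq [a, b] (rev s)"
  shows "b \<le> a"
  using sorted_subseq_pair[OF assms(1)] subseq_rev[OF assms(2)] by simp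

text \<open>The 21-stack stays increasing from top to bottom, so only its top has to be compared.\<close>

lemma contains_21_Cons:
  fixes x y :: nat
  assumes "sorted (y # s)" "x \<notin> set (y # s)"
  shows "contains (x # y # s) [2, 1] \<longleftrightarrow> y < x"
proof -
  have iso: "order_isomorphic [a, b] [2, 1] \<longleftrightarrow> b < a" for a b
    using order_isomorphic_map[of fst "[(a, 2), (b, 1)]" snd] by auto
  show ?thesis
  proof
    assume "y < x"
    then have "subseq [x, y] (x # y # s) \<and> order_isomorphic [x, y] [2, 1]" using iso by simp
    then show "contains (x # y # s) [2, 1]" unfolding contains_def by blast
  next
    assume "contains (x # y # s) [2, 1]"
    then obtain u where u: "subseq u (x # y # s)" "order_isomorphic u [2, 1]"
      unfolding contains_def by blast
    then obtain a b where ab: "u = [a, b]"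
      using order_isomorphic_length[OF u(2)] by (auto simp: length_Suc_conv)
    have "b < a" using u(2) ab iso by simp
    have "\<not> subseq [a, b] (y # s)"
    proof
      assume "subseq [a, b] (y # s)"
      then show False using sorted_subseq_pair[OF assms(1)] \<open>b < a\<close> by fastforce
    qed
    then have "a = x" "b \<in> set (y # s)"
      using u(1) ab subseq_Cons2_neq[of a "[b]" x "y # s"] by (auto simp: subseq_singleton_left split: if_splits)
    then show "y < x" using \<open>b < a\<close> assms(1) by auto
  qed
qed

text \<open>Knuth's criterion, generalized to a nonempty stack: \<open>rev s @ xs\<close> is an input that leads to this
  situation without any pop. When \<open>y\<close> is popped, it spoils sortedness iff a smaller
  letter is still to come; since a larger letter \<open>x\<close> comes first, this is the same as \<open>y\<close> being the 2 of a 231.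
  As the stack is increasing, \<open>y\<close> cannot be the 1 or the 3.\<close>

lemma sorted_stack_run_21:
  assumes "distinct (rev s @ xs)" "sorted s"
  shows "sorted (stack_run [2, 1] xs s) \<longleftrightarrow> \<not> contains (rev s @ xs) [2, 3, 1]"
  using assms
proof (induction "[2, 1] :: nat list" xs s rule: stack_run.induct)
  case (1 s)
  have "\<not> contains (rev s) [2, 3, 1]"
    using 1(2)
  proof (induction s)
    case (Cons x s)
    have "\<not> (\<exists>a b. subseq [a, b] (rev s) \<and> x < a \<and> a < b)"
      using sorted_subseq_pair_rev[of s] Cons.prems by fastforce
    then show ?case using Cons contains_231_insert[of "rev s" x "[]"] by auto
  qed simp
  then show ?case using 1 by simp
next
  case (2 x xs)
  then show ?case by simp
next
  case (3 x xs y s)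
  show ?case
  proof (cases "contains (x # y # s) [2, 1]")
    case False
    then have "x < y" using contains_21_Cons[where y = y and s = s and x = x] 3 by auto
    have "distinct (rev (x # y # s) @ xs)" using "3.prems"(1) by auto
    moreover have "sorted (x # y # s)" using \<open>x < y\<close> "3.prems"(2) by auto
    ultimately show ?thesis using "3.hyps"(2)[OF False] False by simp
  next
    case True
    then have yx: "y < x" using contains_21_Cons[where y = y and s = s and x = x] 3 by auto
    have dec: "\<not> (a < b \<and> subseq [a, b] (rev s))" for a b
      using sorted_subseq_pair_rev[of s a b] "3.prems"(2) by fastforce
    have ys: "\<forall>z\<in>set s. y < z" using 3 by (auto simp: order.strict_iff_order)
    have "straddled y (x # xs) \<longleftrightarrow> (\<exists>z\<in>set xs. z < y)"
      using yx not_straddled_min[of xs y] by (auto simp: not_less) (meson not_less)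
    then have "contains (rev (y # s) @ x # xs) [2, 3, 1] \<longleftrightarrow>
        contains (rev s @ x # xs) [2, 3, 1] \<or> (\<exists>z\<in>set xs. z < y)"
      using contains_231_insert[of "rev s" y "x # xs"] dec ys by auto
    then show ?thesis
      using 3 True yx ys by (auto simp: set_stack_run not_less)
  qed
qed

lemma mem_Sort_iff:
  "\<pi> \<in> Sort \<sigma> \<longleftrightarrow> is_perm \<pi> \<and> \<not> contains (stack_map \<sigma> \<pi>) [2, 3, 1]"
proof (cases "is_perm \<pi>")
  case True
  let ?w = "stack_map \<sigma> \<pi>"
  have "mset ?w = mset \<pi>" by (simp add: stack_map_def mset_stack_run)
  then have "distinct ?w" using True mset_eq_imp_distinct_iff[of ?w \<pi>] by (simp add: is_perm_iff)
  then have sorted: "sorted (stack_map [2, 1] ?w) \<longleftrightarrow> \<not> contains ?w [2, 3, 1]"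
    using sorted_stack_run_21[of "[]" ?w] by (simp add: stack_map_def)
  have "mset (stack_map [2, 1] ?w) = mset \<pi>" by (simp add: stack_map_def mset_stack_run)
  also have "\<dots> = mset [1..<Suc (length \<pi>)]"
  proof -
    have "distinct \<pi>" "set \<pi> = {1..length \<pi>}" using True unfolding is_perm_iff by blast+
    moreover have "set [1..<Suc (length \<pi>)] = {1..length \<pi>}"
      by (simp only: set_upt atLeastLessThanSuc_atLeastAtMost)
    ultimately show ?thesis
      using set_eq_iff_mset_eq_distinct[OF _ distinct_upt, of \<pi> 1 "Suc (length \<pi>)"] by argo
  qed
  finally have mset: "mset (stack_map [2, 1] ?w) = mset [1..<Suc (length \<pi>)]" .
  have "stack_map [2, 1] ?w = [1..<Suc (length \<pi>)] \<longleftrightarrow> sorted (stack_map [2, 1] ?w)"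
  proof
    assume "sorted (stack_map [2, 1] ?w)"
    then show "stack_map [2, 1] ?w = [1..<Suc (length \<pi>)]"
      using properties_for_sort[OF mset] by (simp del: upt_Suc)
  qed (simp del: upt_Suc)
  then show ?thesis using True sorted by (simp add: Sort_def)
qed (simp add: Sort_def)

section \<open>Sortable permutations as a class\<close>

text \<open>Such a \<open>\<sigma>\<close> makes every forced pop produce a 231 in the output.\<close>

lemma mem_Sort_iff_avoids:
  assumes "length \<sigma> \<ge> 2" "contains (swap_first_two \<sigma>) [2, 3, 1]"
  shows "\<pi> \<in> Sort \<sigma> \<longleftrightarrow> is_perm \<pi> \<and> \<not> contains (rev \<pi>) \<sigma> \<and> \<not> contains (rev \<pi>) [2, 3, 1]"
proof (cases "contains (rev \<pi>) \<sigma>")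
  case True
  have "\<not> contains [] \<sigma>" using contains_length[of "[]" \<sigma>] assms(1) by auto
  then have "contains (stack_map \<sigma> \<pi>) (swap_first_two \<sigma>)"
    using stack_run_contains_swap[of \<sigma> "[]" \<pi>] True assms(1) by (simp add: stack_map_def)
  then have "contains (stack_map \<sigma> \<pi>) [2, 3, 1]" using assms(2) by (rule contains_trans)
  then show ?thesis using True by (simp add: mem_Sort_iff)
next
  case False
  then show ?thesis using stack_map_avoiding mem_Sort_iff by auto
qed

lemma perm_class_Sort:
  assumes "length \<sigma> \<ge> 2" "contains (swap_first_two \<sigma>) [2, 3, 1]"
  shows "perm_class (Sort \<sigma>)"
proof -
  have "\<tau> \<in> Sort \<sigma>" if "\<pi> \<in> Sort \<sigma>" "is_perm \<tau>" "contains \<pi> \<tau>" for \<pi> \<tau>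
  proof -
    have "\<not> contains (rev \<tau>) \<rho>" if "\<not> contains (rev \<pi>) \<rho>" for \<rho>
      using that contains_trans[OF contains_rev[OF \<open>contains \<pi> \<tau>\<close>]] by blast
    then show ?thesis using that mem_Sort_iff_avoids[OF assms] by blast
  qed
  then show ?thesis unfolding perm_class_def by (simp add: mem_Sort_iff)
qed

section \<open>Sortable permutations that contain unsortable ones\<close>

text \<open>A permutation of length at least 3 is contained in 231 only if it equals 231, so the stack never
  interferes and 132 is reversed.\<close>

lemma not_mem_Sort_132:
  assumes "is_perm \<sigma>" "length \<sigma> \<ge> 3" "\<sigma> \<noteq> [2, 3, 1]"
  shows "[1, 3, 2] \<notin> Sort \<sigma>"
proof -
  have "\<not> contains [2, 3, 1] \<sigma>"
  proof
    assume c: "contains [2, 3, 1] \<sigma>"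
    then have len: "length \<sigma> = length [2, 3, 1 :: nat]" using contains_length[OF c] assms(2) by simp
    then have iso: "order_isomorphic [2, 3, 1] \<sigma>" using c contains_same_length by metis
    obtain x y z where \<sigma>: "\<sigma> = [x, y, z]" using len by (auto simp: length_Suc_conv)
    have "z < x \<and> x < y"
      using iso order_isomorphic_map[of fst "[(2, x), (3, y), (1, z)]" snd] by (auto simp: \<sigma>)
    moreover have "set [x, y, z] \<subseteq> {1..3}"
      using assms(1) len by (simp add: is_perm_iff \<sigma> numeral_3_eq_3)
    ultimately have "z = 1" "x = 2" "y = 3" by auto
    then show False using assms(3) by (simp add: \<sigma>)
  qed
  then have "stack_map \<sigma> [1, 3, 2] = [2, 3, 1]" using stack_map_avoiding[of "[1, 3, 2]"] by simp
  then show ?thesis by (simp add: mem_Sort_iff)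
qed

lemma not_perm_class_if_sortable_contains_132:
  assumes "is_perm \<sigma>" "length \<sigma> \<ge> 3" "\<sigma> \<noteq> [2, 3, 1]"
    and "\<pi> \<in> Sort \<sigma>" "subseq [a, c, b] \<pi>" "a < b" "b < c"
  shows "\<not> perm_class (Sort \<sigma>)"
proof -
  have "order_isomorphic [a, c, b] [1, 3, 2]"
    using order_isomorphic_map[of fst "[(a, 1), (c, 3), (b, 2)]" snd] assms(6,7) by auto
  then have "contains \<pi> [1, 3, 2]" using assms(5) unfolding contains_def by blast
  moreover have "is_perm [1, 3, 2]" by (auto simp: is_perm_iff)
  ultimately show ?thesis
    using assms(4) not_mem_Sort_132[OF assms(1-3)] unfolding perm_class_def by blast
qed

lemma not_perm_class_Sort_231: "\<not> perm_class (Sort [2, 3, 1])"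
proof -
  have perm: "is_perm [3, 6, 1, 4, 2, 5]" "is_perm [1, 3, 2, 4]" by (auto simp: is_perm_iff)
  have in_Sort: "[3, 6, 1, 4, 2, 5] \<in> Sort [2, 3, 1]"
    by (simp add: mem_Sort_iff perm stack_map_def)
  have notin: "[1, 3, 2, 4] \<notin> Sort [2, 3, 1]"
    by (simp add: mem_Sort_iff stack_map_def)
  have "order_isomorphic [1, 4, 2, 5] [1, 3, 2, 4]"
    using order_isomorphic_map[of fst "[(1, 1), (4, 3), (2, 2), (5, 4)]" snd] by auto
  moreover have "subseq [1, 4, 2, 5] [3, 6, 1, 4, 2, 5 :: nat]" by simp
  ultimately have "contains [3, 6, 1, 4, 2, 5] [1, 3, 2, 4]" unfolding contains_def by blast
  then show ?thesis using perm in_Sort notin unfolding perm_class_def by blast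
qed

text \<open>The new maximum \<open>c\<close> is popped together with \<open>t\<close> when \<open>s\<close> arrives, and the output is \<open>\<sigma>hat\<close> behind
  \<open>c\<close>. The occurrence of 132 is \<open>1 c s\<close>, which needs \<open>s > 1\<close>; that \<open>c\<close> can be pushed needs \<open>s < k\<close>.\<close>

lemma not_perm_class_Sort_first_intermediate:
  assumes perm: "is_perm (s # t # r)" and len: "length (s # t # r) \<ge> 3" and not231: "s # t # r \<noteq> [2, 3, 1]"
    and avoid: "\<not> contains (t # s # r) [2, 3, 1]"
    and s: "1 < s" "s < length (s # t # r)"
  shows "\<not> perm_class (Sort (s # t # r))"
proof -
  let ?\<sigma> = "s # t # r"
  define k where "k = length ?\<sigma>"
  define c where "c = Suc k"
  let ?\<pi> = "rev ([c] @ t # r) @ [s]"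
  have set\<sigma>: "set ?\<sigma> = {1..k}" and dist: "distinct ?\<sigma>" using perm by (auto simp: is_perm_iff k_def)
  have less_c: "\<forall>z\<in>set ?\<sigma>. z < c" unfolding set\<sigma> c_def by auto
  have "k \<in> set ?\<sigma>" unfolding set\<sigma> using len by (simp add: k_def)
  then have k: "k \<in> set (t # r)" "s < k" using s(2) by (auto simp: k_def)
  have "1 \<in> set ?\<sigma>" unfolding set\<sigma> using len by (simp add: k_def)
  then have one: "1 \<in> set (t # r)" using s(1) by auto
  have "\<not> contains ([c] @ t # r) ?\<sigma>"
    using contains_Cons_max[of "t # r" c "t # r" s] contains_length[of "t # r" ?\<sigma>] less_c k by auto
  moreover have "contains (s # t # r) ?\<sigma>" by (simp add: contains_if_order_isomorphic)
  moreover have "\<not> contains (s # r) ?\<sigma>" using contains_length[of "s # r" ?\<sigma>] by auto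
  ultimately have "stack_map ?\<sigma> ?\<pi> = [c] @ t # stack_run ?\<sigma> [] (s # r)"
    by (rule stack_map_one_trigger)
  moreover have "\<not> straddled c (t # s # r)" using less_c by (intro not_straddled_max) auto
  moreover have "is_perm ?\<pi>"
  proof -
    have "set ?\<pi> = insert c (set ?\<sigma>)" by auto
    also have "\<dots> = {1..Suc k}" unfolding set\<sigma> c_def by auto
    finally show ?thesis using dist less_c by (auto simp: is_perm_iff k_def)
  qed
  ultimately have "?\<pi> \<in> Sort ?\<sigma>" using avoid by (auto simp: mem_Sort_iff)
  moreover have "subseq [1, c, s] ?\<pi>"
  proof -
    have "subseq [1] (rev (t # r))" using one by (simp only: subseq_singleton_left set_rev)
    then have "subseq ([1] @ [c, s]) (rev (t # r) @ [c, s])" by (intro list_emb_append_mono) auto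
    then show ?thesis by simp
  qed
  ultimately show ?thesis
    using not_perm_class_if_sortable_contains_132[OF perm len not231, of ?\<pi> 1 c s] s less_c by simp
qed

text \<open>The letters of \<open>\<sigma>\<close> are shifted up by one to make room for a new minimum, so that 2 plays the first
  letter of \<open>\<sigma>\<close> and pops \<open>c\<close> and \<open>t'\<close>. The new minimum 1 sits just below \<open>t'\<close>: any higher and it would
  itself pop \<open>t'\<close>. The output \<open>c t' 2 1 r'\<close> is \<open>\<sigma>hat\<close> with its 1 replaced by the descending
  pair 2 1, behind \<open>c\<close>, which creates no 231.\<close>

lemma not_perm_class_Sort_first_min:
  assumes perm: "is_perm (1 # t # r)" and len: "length (1 # t # r) \<ge> 3"
    and avoid: "\<not> contains (t # 1 # r) [2, 3, 1]"
  shows "\<not> perm_class (Sort (1 # t # r))"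
proof -
  let ?\<sigma> = "1 # t # r"
  define k where "k = length ?\<sigma>"
  define c where "c = Suc (Suc k)"
  define t' where "t' = Suc t"
  define r' where "r' = map Suc r"
  let ?\<pi> = "rev ([c] @ t' # 1 # r') @ [2]"
  have set\<sigma>: "set ?\<sigma> = {1..k}" and dist: "distinct ?\<sigma>" using perm by (auto simp: is_perm_iff k_def)
  have tr: "set (t # r) = {2..k}"
  proof -
    have "set (t # r) = set ?\<sigma> - {1}" using dist by auto
    also have "\<dots> = {2..k}" unfolding set\<sigma> by auto
    finally show ?thesis .
  qed
  have tr': "set (t' # r') = {3..Suc k}"
  proof -
    have "set (t' # r') = Suc ` set (t # r)" by (simp add: t'_def r'_def)
    also have "\<dots> = {3..Suc k}" unfolding tr by (simp add: image_Suc_atLeastAtMost)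
    finally show ?thesis .
  qed
  have "\<forall>z\<in>set (t' # r'). 2 < z \<and> z < c" unfolding tr' c_def by auto
  then have t': "2 < t'" and r': "\<forall>z\<in>set r'. 2 < z" and less_c: "\<forall>z\<in>set (t' # r'). z < c"
    by simp_all
  have dist': "distinct (t' # r')" using dist by (auto simp: t'_def r'_def distinct_map)
  have lens: "length r' = length r" by (simp add: r'_def)
  have min: "\<forall>z\<in>set (t # r). 1 < z" unfolding tr by auto
  have iso: "order_isomorphic (2 # t' # r') ?\<sigma>"
  proof -
    have "2 # t' # r' = map Suc ?\<sigma>" by (simp add: t'_def r'_def)
    moreover have "order_isomorphic (map Suc ?\<sigma>) ?\<sigma>"
      by (rule order_isomorphic_map_strict_mono) (simp add: strict_mono_on_def)
    ultimately show ?thesis by simp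
  qed
  have "\<not> contains (t' # 1 # r') ?\<sigma>"
  proof
    assume "contains (t' # 1 # r') ?\<sigma>"
    then have "order_isomorphic (t' # 1 # r') ?\<sigma>" using contains_same_length[of "t' # 1 # r'" ?\<sigma>] lens by simp
    then show False using order_isomorphic_head_min[of t' "1 # r'" 1 "t # r"] min t' by auto
  qed
  then have "\<not> contains ([c] @ t' # 1 # r') ?\<sigma>"
    using contains_Cons_max[of "t' # 1 # r'" c "t # r" 1] less_c min by (auto simp: c_def)
  moreover have "contains (2 # t' # 1 # r') ?\<sigma>"
    by (rule contains_subseq[OF _ contains_if_order_isomorphic[OF iso]]) auto
  moreover have "\<not> contains (2 # 1 # r') ?\<sigma>"
  proof
    assume "contains (2 # 1 # r') ?\<sigma>"
    then have "order_isomorphic (2 # 1 # r') ?\<sigma>" using contains_same_length[of "2 # 1 # r'" ?\<sigma>] lens by simp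
    then show False using order_isomorphic_head_min[of 2 "1 # r'" 1 "t # r"] min by auto
  qed
  ultimately have "stack_map ?\<sigma> ?\<pi> = [c] @ t' # stack_run ?\<sigma> [] (2 # 1 # r')"
    by (rule stack_map_one_trigger)
  moreover have "\<not> contains (c # t' # 2 # 1 # r') [2, 3, 1]"
  proof -
    have "order_isomorphic (t' # 2 # r') (t # 1 # r)"
      using iso by (rule order_isomorphic_swap)
    then have "\<not> contains (t' # 2 # r') [2, 3, 1]"
      using avoid contains_order_isomorphic_cong by blast
    moreover have "\<not> straddled 1 r'" "\<not> straddled 2 r'" 
      using r' by (auto intro!: not_straddled_min less_imp_le)
    moreover have "\<not> straddled c (t' # 2 # 1 # r')"
      using less_c by (intro not_straddled_max) (auto simp: c_def)
    ultimately show ?thesis using t' r' by auto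
  qed
  moreover have "is_perm ?\<pi>"
  proof -
    have "set ?\<pi> = {1, 2, c} \<union> set (t' # r')" by auto
    also have "\<dots> = {1..Suc (Suc k)}" unfolding tr' c_def by (auto simp: k_def)
    finally show ?thesis using dist' less_c t' r' by (auto simp: is_perm_iff k_def c_def lens)
  qed
  ultimately have "?\<pi> \<in> Sort ?\<sigma>" by (simp add: mem_Sort_iff)
  moreover have "subseq [1, c, 2] ?\<pi>"
  proof -
    have "subseq [1, c, 2] [1, t', c, 2]" by simp
    then have "subseq [1, c, 2] (rev r' @ [1, t', c, 2])" by (rule list_emb_append2)
    then show ?thesis by simp
  qed
  ultimately show ?thesis
    using not_perm_class_if_sortable_contains_132[OF perm len, of ?\<pi> 1 c 2] less_c t' by simp
qed

text \<open>Here a new maximum would itself force pops, so it is used for that: \<open>K\<close> pops 3 and 1, and \<open>K\<close>, 1 and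
  \<open>r'\<close> form a copy of \<open>\<sigma>\<close>. Then 2 is pushed on top of \<open>K\<close>, and the letters of \<open>1 3 2\<close> leave the stack in
  the harmless order \<open>3 1 2\<close>.\<close>

lemma not_perm_class_Sort_first_max:
  assumes perm: "is_perm (k # t # r)" and len: "length (k # t # r) \<ge> 3"
    and k: "k = length (k # t # r)"
    and avoid: "\<not> contains (t # k # r) [2, 3, 1]"
  shows "\<not> perm_class (Sort (k # t # r))"
proof -
  let ?\<sigma> = "k # t # r"
  define K where "K = Suc (Suc k)"
  define r' where "r' = map (\<lambda>x. Suc (Suc x)) r"
  let ?\<pi> = "rev ([3] @ 1 # r') @ K # [2]"
  have set\<sigma>: "set ?\<sigma> = {1..k}" and dist: "distinct ?\<sigma>" using perm k by (auto simp: is_perm_iff)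
  have max: "\<forall>z\<in>set (t # r). z < k"
  proof
    fix z assume "z \<in> set (t # r)"
    then have "z \<in> set ?\<sigma>" "z \<noteq> k" using dist by auto
    then show "z < k" unfolding set\<sigma> by auto
  qed
  have t: "t = 1"
  proof (rule ccontr)
    assume "t \<noteq> 1"
    (* 1 lies in r, so t, k and 1 would form a 231 in t # k # r. *)
    have "1 < k" using len k by simp
    then have "1 \<in> set ?\<sigma>" unfolding set\<sigma> by simp
    then have "1 \<in> set r" using \<open>t \<noteq> 1\<close> \<open>1 < k\<close> by simp
    have "t \<in> set ?\<sigma>" by simp
    then have "1 < t" using \<open>t \<noteq> 1\<close> unfolding set\<sigma> by simp
    then have "straddled t (k # r)" using max \<open>1 \<in> set r\<close> by auto
    then show False using avoid by simp
  qed
  have r: "set r = {2..<k}"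
  proof -
    have "set r = set ?\<sigma> - {1, k}" using dist t by auto
    also have "\<dots> = {2..<k}" unfolding set\<sigma> by auto
    finally show ?thesis .
  qed
  have r': "set r' = {4..<K}"
  proof -
    have "set r' = Suc ` Suc ` {2..<k}" by (simp add: r'_def r[symmetric] image_image)
    then show ?thesis by (simp add: K_def image_Suc_atLeastLessThan)
  qed
  have dist': "distinct r'" using dist by (auto simp: r'_def distinct_map inj_on_def)
  have lens: "length r' = length r" by (simp add: r'_def)
  have "r' \<noteq> []" using len by (auto simp: r'_def)
  then obtain z where z: "z \<in> set r'" by (cases r') auto
  have K: "4 < K" using z r' by auto
  have iso: "order_isomorphic (K # 1 # r') ?\<sigma>"
  proof -
    let ?f = "\<lambda>x. if x = 1 then 1 else Suc (Suc x)"
    have "K # 1 # r' = map ?f ?\<sigma>" using dist t len k by (auto simp: r'_def K_def)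
    moreover have "order_isomorphic (map ?f ?\<sigma>) ?\<sigma>"
      by (rule order_isomorphic_map_strict_mono) (auto simp: strict_mono_on_def set\<sigma> simp del: list.set)
    ultimately show ?thesis by simp
  qed
  have "\<not> contains ([3] @ 1 # r') ?\<sigma>"
  proof
    assume "contains ([3] @ 1 # r') ?\<sigma>"
    then have "order_isomorphic (3 # 1 # r') ?\<sigma>" using contains_same_length[of "3 # 1 # r'" ?\<sigma>] lens by simp
    then show False using order_isomorphic_head_max[of 3 "1 # r'" k "t # r"] max z r' by auto
  qed
  moreover have "contains (K # 1 # r') ?\<sigma>" using iso by (rule contains_if_order_isomorphic)
  moreover have "\<not> contains (K # r') ?\<sigma>" using contains_length[of "K # r'" ?\<sigma>] lens by auto
  ultimately have "stack_map ?\<sigma> ?\<pi> = [3] @ 1 # stack_run ?\<sigma> [2] (K # r')"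
    by (rule stack_map_one_trigger)
  moreover have "\<not> contains (2 # K # r') ?\<sigma>"
  proof
    assume "contains (2 # K # r') ?\<sigma>"
    then have "order_isomorphic (2 # K # r') ?\<sigma>" using contains_same_length[of "2 # K # r'" ?\<sigma>] lens by simp
    then show False using order_isomorphic_head_max[of 2 "K # r'" k "t # r"] max K by auto
  qed
  then have "stack_run ?\<sigma> [2] (K # r') = 2 # K # r'" by simp
  moreover have "\<not> contains (3 # 1 # 2 # K # r') [2, 3, 1]"
  proof -
    have "order_isomorphic (1 # K # r') (t # k # r)"
      using iso by (rule order_isomorphic_swap)
    then have "\<not> contains (1 # K # r') [2, 3, 1]"
      using avoid contains_order_isomorphic_cong by blast
    moreover have "\<not> straddled 2 r'" "\<not> straddled 1 r'" "\<not> straddled 3 r'"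
      using r' by (auto intro!: not_straddled_min)
    ultimately show ?thesis using r' K by auto
  qed
  moreover have "is_perm ?\<pi>"
  proof -
    have "set ?\<pi> = {1, 2, 3, K} \<union> set r'" by auto
    also have "\<dots> = {1..K}" using K unfolding r' by auto
    finally show ?thesis using dist' K r' k by (auto simp: is_perm_iff K_def lens)
  qed
  ultimately have "?\<pi> \<in> Sort ?\<sigma>" by (simp add: mem_Sort_iff)
  moreover have "subseq [1, 3, 2] ?\<pi>"
  proof -
    have "subseq [1, 3, 2] [1, 3, K, 2]" by simp
    then have "subseq [1, 3, 2] (rev r' @ [1, 3, K, 2])" by (rule list_emb_append2)
    then show ?thesis by simp
  qed
  moreover have "?\<sigma> \<noteq> [2, 3, 1]" using t by simp
  ultimately show ?thesis
    using not_perm_class_if_sortable_contains_132[OF perm len, of ?\<pi> 1 3 2] by simp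
qed

theorem corollary3p9:
  fixes \<sigma> :: "nat list"
  assumes "is_perm \<sigma>" and "length \<sigma> \<ge> 3"
  shows "perm_class (Sort \<sigma>) \<longleftrightarrow> contains (swap_first_two \<sigma>) [2, 3, 1]"
proof
  assume "contains (swap_first_two \<sigma>) [2, 3, 1]"
  then show "perm_class (Sort \<sigma>)" using assms(2) by (intro perm_class_Sort) auto
next
  assume "perm_class (Sort \<sigma>)"
  show "contains (swap_first_two \<sigma>) [2, 3, 1]"
  proof (rule ccontr)
    assume avoid: "\<not> contains (swap_first_two \<sigma>) [2, 3, 1]"
    obtain s t r where \<sigma>: "\<sigma> = s # t # r"
      using assms(2) by (cases \<sigma> rule: swap_first_two.cases) auto
    have "s \<in> {1..length \<sigma>}" using assms(1) unfolding is_perm_iff by (metis \<sigma> list.set_intros(1))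
    then consider "s = 1" | "s = length \<sigma>" | "1 < s" "s < length \<sigma>" by force
    then have "\<not> perm_class (Sort \<sigma>)"
    proof cases
      case 1
      then show ?thesis using not_perm_class_Sort_first_min[of t r] assms avoid unfolding \<sigma> by simp
    next
      case 2
      then show ?thesis using not_perm_class_Sort_first_max[of s t r] assms avoid unfolding \<sigma> by simp
    next
      case 3
      then show ?thesis
        using not_perm_class_Sort_first_intermediate[of s t r] not_perm_class_Sort_231 assms avoid unfolding \<sigma> by fastforce
    qed
    then show False using \<open>perm_class (Sort \<sigma>)\<close> by blast
  qed
qed

end
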